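(* Let $n \in \mathbb{N}$ and let $W : \mathbb{N}^n \rightarrow \mathbb{N}$ be any function. If $\mathcal{A} \subseteq \mathbb{N}^n$ is partition regular, then the exponential $\mathcal{A}$-pattern with weight $W$ is also partition regular.
   Context: A collection $\mathcal{A}$ of ordered tuples of positive integers is partition regular if for every finite colouring $f$ of $\mathbb{N}$ (a map from $\mathbb{N}$ to a finite set) there is a tuple $(x_1,\ldots,x_m) \in \mathcal{A}$ with $f(x_1)=\cdots=f(x_m)$. For $\mathcal{A} \subseteq \mathbb{N}^n$ and $W:\mathbb{N}^n\to\mathbb{N}$, the exponential $\mathcal{A}$-pattern with weight $W$ is the collection consisting of, for each $(x_1,\ldots,x_n) \in \mathcal{A}$ and each pair of integers $a,b>1$, the $(W(x_1,\ldots,x_n)+n+1)$-tuple \[ \bigl(a,\ b^{x_1},\ldots,b^{x_n},\ a^{b^1}, a^{b^2},\ldots, a^{b^{W(x_1,\ldots,x_n)}}\bigr). \] *)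

theory Defs
  imports Main
begin

text \<open>
  Throughout, the natural numbers of the mathematics are the positive integers, that is
  \<^term>\<open>{1..} :: nat set\<close>, and tuples are lists.
\<close>

definition pos_tuples :: "nat \<Rightarrow> nat list set" where
  "pos_tuples n = {xs. length xs = n \<and> set xs \<subseteq> {1..}}"

text \<open>
  A finite colouring takes only finitely many values on the positive integers (its value at 0 is
  irrelevant). Taking colours in \<^typ>\<open>nat\<close> is no restriction, as every finite set embeds in it.
\<close>

definition finite_colouring :: "(nat \<Rightarrow> nat) \<Rightarrow> bool" where
  "finite_colouring f \<longleftrightarrow> finite (f ` {1..})"

text \<open>Meant for collections of tuples with positive entries.\<close>

definition partition_regular :: "nat list set \<Rightarrow> bool" where
  "partition_regular A \<longleftrightarrow>
     (\<forall>f. finite_colouring f \<longrightarrow> (\<exists>xs\<in>A. \<forall>x\<in>set xs. \<forall>y\<in>set xs. f x = f y))"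

definition exponential_pattern :: "nat list set \<Rightarrow> (nat list \<Rightarrow> nat) \<Rightarrow> nat list set" where
  "exponential_pattern A W =
     {a # map (\<lambda>x. b ^ x) xs @ map (\<lambda>j. a ^ (b ^ j)) [1..<Suc (W xs)] | a b xs.
        xs \<in> A \<and> a > 1 \<and> b > 1}"

end

theory Submission
  imports Defs "HOL-Library.FuncSet" "HOL-Library.Infinite_Set"
begin

text \<open>
  On powers of 2, with \<open>a = 2 ^ (x * \<alpha>)\<close> and \<open>b = 2 ^ \<beta>\<close>, the pattern asks for exponents \<open>x * \<alpha> * 2 ^ (j * \<beta>)\<close>
  and \<open>y * \<beta>\<close> of one colour under \<open>g k = f (2 ^ k)\<close>, where \<open>y\<close> runs through a tuple \<open>xs\<close> of \<open>A\<close> and \<open>x\<close> is one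
  of its entries. It suffices to find \<open>\<alpha>\<close> and \<open>\<beta>\<close> such that \<open>\<beta>\<close> and all \<open>\<alpha> * 2 ^ (j * \<beta>)\<close> with
  \<open>j \<le> L\<close> have the same colour under the vector colouring \<open>y \<mapsto> (g (x * y))\<close>, \<open>x \<le> M\<close>: then
  colour \<open>x\<close> by \<open>g (x * \<beta>)\<close> and use partition regularity of \<open>A\<close>, with \<open>M\<close> given by compactness.

  Such \<open>\<alpha>\<close> and \<open>\<beta>\<close> exist for every finite colouring \<open>g\<close>, by a Brauer-type argument. If a progression
  \<open>\<alpha> * 2 ^ (j * \<beta>)\<close> of colour \<open>c\<close> is present, then \<open>\<beta>\<close> must avoid \<open>c\<close>. Van der Waerden's theorem on
  exponents, applied to \<open>s \<mapsto> g (x * 2 ^ s)\<close>, gives this for all \<open>\<beta>\<close> in a rich set of differences,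
  and repeating this inside that set rules out one colour after the other.
\<close>

section \<open>Van der Waerden's theorem\<close>

text \<open>Progressions are read backwards from their common focus \<open>b\<close>, whose own
  colour is left free: once \<open>f b\<close> lies in this set, some progression gains a
  term.\<close>

definition focused_colours :: "nat \<Rightarrow> (nat \<Rightarrow> 'c) \<Rightarrow> nat \<Rightarrow> 'c set" where
  "focused_colours l f b = {c. \<exists>d>0. l * d \<le> b \<and> (\<forall>j\<in>{1..l}. f (b - j * d) = c)}"

lemma colouring_as_nat:
  fixes f :: "nat \<Rightarrow> 'c"
  assumes "finite S"
  obtains f' :: "nat \<Rightarrow> nat" where "card (f' ` S) = card (f ` S)"
    and "\<And>x y. x \<in> S \<Longrightarrow> y \<in> S \<Longrightarrow> f' x = f' y \<longleftrightarrow> f x = f y"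
proof -
  obtain h :: "'c \<Rightarrow> nat" where h: "inj_on h (f ` S)"
    using finite_imp_inj_to_nat_seg[of "f ` S"] assms by blast
  show ?thesis
  proof (rule that[of "h \<circ> f"])
    show "card ((h \<circ> f) ` S) = card (f ` S)"
      using card_image[OF h] by (simp add: image_comp)
  qed (use h in \<open>auto simp: inj_on_eq_iff\<close>)
qed

text \<open>Colours live in \<open>nat\<close> since HOL cannot quantify over colour types;
  \<open>colouring_as_nat\<close> carries the bound over to vector colourings.\<close>

definition vdw_bound :: "nat \<Rightarrow> nat \<Rightarrow> nat \<Rightarrow> bool" where
  "vdw_bound l r N \<longleftrightarrow>
     (\<forall>f::nat \<Rightarrow> nat. card (f ` {..N}) \<le> r \<longrightarrow> (\<exists>b\<le>N. focused_colours l f b \<noteq> {}))"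

text \<open>The focus \<open>a + l * t\<close> has no prescribed colour but stays in range: in
  \<open>focusing\<close> it indexes the block of the new focus.\<close>

lemma vdw_bound_block:
  fixes F :: "nat \<Rightarrow> 'c"
  assumes "vdw_bound l r N" and "card (F ` {..N}) \<le> r"
  obtains a t where "t > 0" "a + l * t \<le> N" "\<And>i j. i < l \<Longrightarrow> j < l \<Longrightarrow> F (a + i * t) = F (a + j * t)"
proof -
  obtain F' :: "nat \<Rightarrow> nat" where F': "card (F' ` {..N}) = card (F ` {..N})"
    "\<And>x y. x \<in> {..N} \<Longrightarrow> y \<in> {..N} \<Longrightarrow> F' x = F' y \<longleftrightarrow> F x = F y"
    using colouring_as_nat[of "{..N}" F] by auto
  obtain b c where b: "b \<le> N" "c \<in> focused_colours l F' b"
    using assms(1)[unfolded vdw_bound_def, rule_format, of F'] assms(2) F'(1) by auto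
  then obtain d where d: "d > 0" "l * d \<le> b" "\<forall>j\<in>{1..l}. F' (b - j * d) = c"
    unfolding focused_colours_def by blast
  show ?thesis
  proof (rule that[of d "b - l * d"])
    have *: "F' (b - l * d + i * d) = c" "b - l * d + i * d \<le> N" if "i < l" for i
    proof -
      have "i * d \<le> l * d" using that by simp
      moreover have "(l - i) * d = l * d - i * d" by (simp add: diff_mult_distrib)
      ultimately have e: "b - l * d + i * d = b - (l - i) * d" using d(2) by linarith
      then show "F' (b - l * d + i * d) = c" using d(3) that by auto
      show "b - l * d + i * d \<le> N" using e b(1) by linarith
    qed
    show "F (b - l * d + i * d) = F (b - l * d + j * d)" if "i < l" "j < l" for i j
      using F'(2) *[OF that(1)] *[OF that(2)] by auto
  qed (use b d in auto)
qed

lemma focused_colours_subset: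
  assumes "l \<ge> 1"
  shows "focused_colours l f b \<subseteq> f ` {..b}"
proof
  fix c assume "c \<in> focused_colours l f b"
  then obtain d where d: "\<forall>j\<in>{1..l}. f (b - j * d) = c"
    unfolding focused_colours_def by blast
  then have "f (b - 1 * d) = c" using assms by (meson atLeastAtMost_iff order_refl)
  then show "c \<in> f ` {..b}" by auto
qed

text \<open>Colour focusing: find \<open>l\<close> equally coloured blocks of length
  \<open>M\<close> in progression and add the block step to each difference focused at
  \<open>b\<close>. The old colours survive, and the copies of \<open>b\<close> itself contribute a
  new one.\<close>

lemma focusing:
  assumes l: "l \<ge> 1" and vdw: "\<And>r. \<exists>N. vdw_bound l r N"
  shows "\<exists>N. \<forall>f::nat \<Rightarrow> nat. card (f ` {..N}) \<le> r \<longrightarrow>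
           (\<exists>b\<le>N. f b \<in> focused_colours l f b \<or> k \<le> card (focused_colours l f b))"
proof (induction k)
  case 0
  then show ?case by auto
next
  case (Suc k)
  then obtain N where N: "\<And>f::nat \<Rightarrow> nat. card (f ` {..N}) \<le> r \<Longrightarrow>
      \<exists>b\<le>N. f b \<in> focused_colours l f b \<or> k \<le> card (focused_colours l f b)" by blast
  define M where "M = Suc N"
  obtain V where V: "vdw_bound l (r ^ M) V" using vdw by blast
  define N' where "N' = V * M + N"
  show ?case
  proof (rule exI[of _ N'], intro allI impI)
    fix f :: "nat \<Rightarrow> nat" assume f: "card (f ` {..N'}) \<le> r"
    define F where "F i = restrict (\<lambda>z. f (i * M + z)) {..N}" for i
    have bound: "i * M + z \<le> N'" if "i \<le> V" "z \<le> N" for i z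
      using that mult_le_mono1[of i V M] unfolding N'_def by linarith
    have "F ` {..V} \<subseteq> {..N} \<rightarrow>\<^sub>E f ` {..N'}"
      unfolding F_def image_subset_iff using bound by (simp add: restrict_PiE_iff)
    then have "card (F ` {..V}) \<le> card ({..N} \<rightarrow>\<^sub>E f ` {..N'})"
      by (intro card_mono finite_PiE) auto
    also have "\<dots> = card (f ` {..N'}) ^ M" by (simp add: card_PiE M_def)
    also have "\<dots> \<le> r ^ M" using f by (intro power_mono) auto
    finally obtain a t where t: "t > 0" and at: "a + l * t \<le> V"
      and FF: "\<And>i j. i < l \<Longrightarrow> j < l \<Longrightarrow> F (a + i * t) = F (a + j * t)"
      using vdw_bound_block[OF V] by metis
    have aV: "a \<le> V" using at by simp
    define f0 where "f0 z = f (a * M + z)" for z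
    have blk: "f ((a + i * t) * M + z) = f0 z" if "i < l" "z \<le> N" for i z
      using fun_cong[OF FF[of i 0], of z] that l by (simp add: F_def f0_def)
    have "f0 ` {..N} \<subseteq> f ` {..N'}" using bound[OF aV] by (auto simp: f0_def)
    then have "card (f0 ` {..N}) \<le> r" 
      using card_mono[of "f ` {..N'}" "f0 ` {..N}"] f by simp
    from N[OF this] obtain b where bN: "b \<le> N"
      and b: "f0 b \<in> focused_colours l f0 b \<or> k \<le> card (focused_colours l f0 b)" by blast
    show "\<exists>b\<le>N'. f b \<in> focused_colours l f b \<or> Suc k \<le> card (focused_colours l f b)"
    proof (cases "f0 b \<in> focused_colours l f0 b")
      case True
      then obtain d where d: "d > 0" "l * d \<le> b" "\<forall>j\<in>{1..l}. f0 (b - j * d) = f0 b"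
        unfolding focused_colours_def by blast
      have "f (a * M + b - j * d) = f (a * M + b)" if "j \<in> {1..l}" for j
      proof -
        have "j * d \<le> l * d" using that by simp
        then have "a * M + b - j * d = a * M + (b - j * d)" using d(2) by linarith
        then show ?thesis using d(3) that by (simp add: f0_def)
      qed
      then have "f (a * M + b) \<in> focused_colours l f (a * M + b)"
        unfolding focused_colours_def using d by auto
      then show ?thesis using bound[OF aV bN] by blast
    next
      case False
      \<comment> \<open>The new focus sits in the block that follows the \<open>l\<close> equal
        ones.\<close>
      define b' where "b' = (a + l * t) * M + b"
      have shift: "b' - j * (d + t * M) = (a + (l - j) * t) * M + (b - j * d)"
        if "l * d \<le> b" "j \<in> {1..l}" for j d
      proof -
        obtain i where i: "l = i + j" using \<open>j \<in> {1..l}\<close> by (metis add.commute atLeastAtMost_iff le_Suc_ex)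
        have jd: "j * d \<le> b" using that i by (simp add: algebra_simps)
        then obtain e where e: "b = j * d + e" using le_Suc_ex by blast
        show ?thesis unfolding b'_def i e by (simp add: algebra_simps)
      qed
      have "c \<in> focused_colours l f b'" if c: "c \<in> focused_colours l f0 b" for c
      proof -
        from c obtain d where d: "d > 0" "l * d \<le> b" "\<forall>j\<in>{1..l}. f0 (b - j * d) = c"
          unfolding focused_colours_def by blast
        have "f (b' - j * (d + t * M)) = c" if "j \<in> {1..l}" for j
          using shift[OF d(2) that] blk[of "l - j" "b - j * d"] d(3) that bN by auto
        moreover have "l * (d + t * M) \<le> b'" using d(2) by (simp add: b'_def algebra_simps)
        ultimately show ?thesis
          unfolding focused_colours_def using d(1) by (intro CollectI exI[of _ "d + t * M"]) auto
      qed
      moreover have "f0 b \<in> focused_colours l f b'"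
      proof -
        have "f (b' - j * (t * M)) = f0 b" if "j \<in> {1..l}" for j
          using shift[of 0 j] blk[of "l - j" b] that bN by auto
        moreover have "l * (t * M) \<le> b'" by (simp add: b'_def algebra_simps)
        ultimately show ?thesis
          unfolding focused_colours_def using t by (intro CollectI exI[of _ "t * M"]) (auto simp: M_def)
      qed
      ultimately have sub: "insert (f0 b) (focused_colours l f0 b) \<subseteq> focused_colours l f b'" by blast
      have fin: "finite (focused_colours l h x)" for h :: "nat \<Rightarrow> nat" and x
        by (rule finite_subset[OF focused_colours_subset[OF l]]) simp
      have "Suc k \<le> card (insert (f0 b) (focused_colours l f0 b))" using b False fin by simp
      also have "\<dots> \<le> card (focused_colours l f b')" by (intro card_mono fin sub)
      finally show ?thesis using bound[OF at bN] by (auto simp flip: b'_def)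
    qed
  qed
qed

lemma vdw_bound_exists: "\<exists>N. vdw_bound (Suc l) r N"
proof (induction l arbitrary: r)
  case 0
  have "f 0 \<in> focused_colours (Suc 0) f 1" for f :: "nat \<Rightarrow> nat"
    by (auto simp: focused_colours_def intro!: exI[of _ 1])
  then show ?case unfolding vdw_bound_def by (metis empty_iff order_refl)
next
  case (Suc l)
  let ?l = "Suc l"
  obtain N where N: "\<And>f::nat \<Rightarrow> nat. card (f ` {..N}) \<le> r \<Longrightarrow>
      \<exists>b\<le>N. f b \<in> focused_colours ?l f b \<or> Suc r \<le> card (focused_colours ?l f b)"
    using focusing[of ?l r "Suc r"] Suc by auto
  \<comment> \<open>Once \<open>f b\<close> counts as a term, the focus moves to
    \<open>b + d\<close>, and \<open>d \<le> b \<le> N\<close>.\<close>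
  show ?case unfolding vdw_bound_def
  proof (rule exI[of _ "2 * N"], intro allI impI)
    fix f :: "nat \<Rightarrow> nat" assume f: "card (f ` {..2 * N}) \<le> r"
    have le: "card (f ` {..x}) \<le> r" if "x \<le> N" for x
      using f card_mono[of "f ` {..2 * N}" "f ` {..x}"] that by fastforce
    obtain b where bN: "b \<le> N"
      and b: "f b \<in> focused_colours ?l f b \<or> Suc r \<le> card (focused_colours ?l f b)"
      using N[OF le[OF order_refl]] by blast
    \<comment> \<open>With at most \<open>r\<close> colours, \<open>r + 1\<close> focused ones are
      impossible.\<close>
    have "card (focused_colours ?l f b) \<le> card (f ` {..b})"
      by (intro card_mono focused_colours_subset) auto
    then have "f b \<in> focused_colours ?l f b" using b le[OF bN] by linarith
    then obtain d where d: "d > 0" "?l * d \<le> b" "\<forall>j\<in>{1..?l}. f (b - j * d) = f b"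
      unfolding focused_colours_def by blast
    have "f (b + d - j * d) = f b" if "j \<in> {1..Suc ?l}" for j
    proof (cases "j = 1")
      case False
      then have "j - 1 \<in> {1..?l}" using that by auto
      moreover have "b + d - j * d = b - (j - 1) * d"
        using that by (cases j) auto
      ultimately show ?thesis using d(3) by auto
    qed simp
    then have "f b \<in> focused_colours (Suc ?l) f (b + d)"
      unfolding focused_colours_def using d by auto
    moreover have "b + d \<le> 2 * N" using d(2) bN by simp
    ultimately show "\<exists>b\<le>2 * N. focused_colours (Suc ?l) f b \<noteq> {}" by blast
  qed
qed

theorem van_der_Waerden:
  "\<exists>N. \<forall>f::nat \<Rightarrow> 'c. card (f ` {..N}) \<le> r \<longrightarrow>
     (\<exists>a t. t > 0 \<and> a + l * t \<le> N \<and> (\<forall>j\<le>l. f (a + j * t) = f a))"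
proof -
  obtain N where N: "vdw_bound (Suc l) r N" using vdw_bound_exists by blast
  show ?thesis
  proof (rule exI[of _ N], intro allI impI)
    fix f :: "nat \<Rightarrow> 'c" assume "card (f ` {..N}) \<le> r"
    then obtain a t where "t > 0" and at: "a + Suc l * t \<le> N"
      and f: "\<And>i j. i < Suc l \<Longrightarrow> j < Suc l \<Longrightarrow> f (a + i * t) = f (a + j * t)"
      using vdw_bound_block[OF N] by metis
    have "f (a + j * t) = f a" if "j \<le> l" for j using f[of j 0] that by simp
    then show "\<exists>a t. t > 0 \<and> a + l * t \<le> N \<and> (\<forall>j\<le>l. f (a + j * t) = f a)"
      using \<open>t > 0\<close> at by (intro exI[of _ a] exI[of _ t]) auto
  qed
qed

section \<open>Extension games\<close>

definition extend :: "nat set \<Rightarrow> nat \<Rightarrow> nat \<Rightarrow> nat set" where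
  "extend Z p x = {z + j * x | z j. z \<in> Z \<and> j \<le> p}"

text \<open>
  In each of \<open>k\<close> rounds we name a bound \<open>p\<close>, the opponent answers with a step \<open>x\<close>, and \<open>Z\<close> grows
  by the multiples \<open>j * x\<close> with \<open>j \<le> p\<close>. Each bound may thus depend on the earlier steps, which
  breaks the circularity between lengths and differences of progressions.
\<close>

fun wins :: "nat \<Rightarrow> (nat set \<Rightarrow> bool) \<Rightarrow> nat set \<Rightarrow> bool" where
  "wins 0 \<Phi> Z = \<Phi> Z"
| "wins (Suc k) \<Phi> Z = (\<exists>p. \<forall>x\<ge>1. wins k \<Phi> (extend Z p x))"

lemma wins_mono: "wins k \<Phi> Z \<Longrightarrow> (\<And>Z. \<Phi> Z \<Longrightarrow> \<Psi> Z) \<Longrightarrow> wins k \<Psi> Z"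
proof (induction k arbitrary: Z)
  case (Suc k)
  then obtain p where "\<forall>x\<ge>1. wins k \<Phi> (extend Z p x)" by auto
  then have "\<forall>x\<ge>1. wins k \<Psi> (extend Z p x)" using Suc by blast
  then show ?case by auto
qed simp

lemma wins_wins: "wins k (wins m \<Phi>) Z \<Longrightarrow> wins (k + m) \<Phi> Z"
  by (induction k arbitrary: Z) (simp, fastforce)

lemma wins_ex: "wins k \<Phi> Z \<Longrightarrow> \<exists>Z. \<Phi> Z"
  by (induction k arbitrary: Z) auto

lemma finite_extend: "finite Z \<Longrightarrow> finite (extend Z p x)"
proof -
  assume "finite Z"
  moreover have "extend Z p x = (\<lambda>(z, j). z + j * x) ` (Z \<times> {..p})"
    unfolding extend_def by auto
  ultimately show ?thesis by simp
qed

lemma subset_extend: "Z \<subseteq> extend Z p x"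
  unfolding extend_def by force

text \<open>\<open>Z\<close> supplies the differences, all sharing one base point and one colour.
  Finiteness allows vector colourings over \<open>Z'\<close>; \<open>0\<close> puts the multiples
  \<open>j * x\<close> into its extensions.\<close>

definition mono_copy :: "'c set \<Rightarrow> nat \<Rightarrow> (nat set \<Rightarrow> bool) \<Rightarrow> nat set \<Rightarrow> bool" where
  "mono_copy C L \<Phi> Z' \<longleftrightarrow> finite Z' \<and> 0 \<in> Z' \<and>
     (\<forall>\<chi>. \<chi> ` Z' \<subseteq> C \<longrightarrow>
       (\<exists>a Z c. \<Phi> Z \<and> Z \<subseteq> Z' \<and> (\<forall>z\<in>Z. \<forall>j\<le>L. a + j * z \<in> Z' \<and> \<chi> (a + j * z) = c)))"

lemma mono_copyE:
  assumes "mono_copy C L \<Phi> Z'" and "\<chi> ` Z' \<subseteq> C"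
  obtains a Z c where "\<Phi> Z" "Z \<subseteq> Z'"
    and "\<And>z j. z \<in> Z \<Longrightarrow> j \<le> L \<Longrightarrow> a + j * z \<in> Z' \<and> \<chi> (a + j * z) = c"
proof -
  have "\<exists>a Z c. \<Phi> Z \<and> Z \<subseteq> Z' \<and> (\<forall>z\<in>Z. \<forall>j\<le>L. a + j * z \<in> Z' \<and> \<chi> (a + j * z) = c)"
    using assms unfolding mono_copy_def by simp
  then show ?thesis using that by blast
qed

text \<open>A step \<open>x\<close> from \<open>Z'\<close> is simulated by the step
  \<open>t * x\<close> from \<open>Z\<close>: by van der Waerden, the vector of colours on the
  translate of \<open>Z'\<close> by \<open>j * x\<close> is constant for \<open>j\<close> in a
  progression of difference \<open>t\<close>.\<close>

lemma mono_copy_extend: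
  fixes C :: "'c set"
  assumes C: "finite C" and mc: "mono_copy C L (wins (Suc k) \<Phi>) Z'"
  shows "\<exists>P. \<forall>x\<ge>1. mono_copy C L (wins k \<Phi>) (extend Z' P x)"
proof -
  have fin: "finite Z'" and "0 \<in> Z'" using mc by (auto simp: mono_copy_def)
  have "\<forall>Z. \<exists>p. wins (Suc k) \<Phi> Z \<longrightarrow> (\<forall>x\<ge>1. wins k \<Phi> (extend Z p x))" by auto
  then obtain p where p: "\<And>Z x. wins (Suc k) \<Phi> Z \<Longrightarrow> x \<ge> 1 \<Longrightarrow> wins k \<Phi> (extend Z (p Z) x)"
    by metis
  \<comment> \<open>\<open>Z\<close> depends on a colouring not known when \<open>P\<close> is
    named, so \<open>q\<close> dominates the bounds of all subsets of \<open>Z'\<close>.\<close>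
  define q where "q = Max (p ` Pow Z')"
  have q: "p Z \<le> q" if "Z \<subseteq> Z'" for Z
    using that fin unfolding q_def by (intro Max_ge) auto
  \<comment> \<open>Multipliers \<open>j * i\<close> with \<open>j \<le> L\<close>,
    \<open>i \<le> q\<close> occur below; \<open>Suc L\<close> also secures
    \<open>q * t \<le> P\<close> when \<open>L = 0\<close>.\<close>
  obtain P where P: "\<And>f::nat \<Rightarrow> (nat \<Rightarrow> 'c). card (f ` {..P}) \<le> card (Z' \<rightarrow>\<^sub>E C) \<Longrightarrow>
      \<exists>a t. t > 0 \<and> a + (Suc L * q) * t \<le> P \<and> (\<forall>j\<le>Suc L * q. f (a + j * t) = f a)"
    using van_der_Waerden[of "card (Z' \<rightarrow>\<^sub>E C)" "Suc L * q"] by blast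
  show ?thesis
  proof (rule exI[of _ P], intro allI impI)
    fix x :: nat assume x: "x \<ge> 1"
    let ?E = "extend Z' P x"
    have "\<exists>a Z c. wins k \<Phi> Z \<and> Z \<subseteq> ?E \<and> (\<forall>z\<in>Z. \<forall>j\<le>L. a + j * z \<in> ?E \<and> \<chi> (a + j * z) = c)"
      if \<chi>: "\<chi> ` ?E \<subseteq> C" for \<chi>
    proof -
      have inE: "z + j * x \<in> ?E" if "z \<in> Z'" "j \<le> P" for z j
        using that unfolding extend_def by blast
      define f where "f j = restrict (\<lambda>z. \<chi> (z + j * x)) Z'" for j
      have "f ` {..P} \<subseteq> Z' \<rightarrow>\<^sub>E C" unfolding f_def image_subset_iff using \<chi> inE by (auto simp: restrict_PiE_iff)
      then have "card (f ` {..P}) \<le> card (Z' \<rightarrow>\<^sub>E C)"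
        using fin C by (intro card_mono finite_PiE) auto
      from P[OF this] obtain a' t where t: "t > 0" and at: "a' + (Suc L * q) * t \<le> P"
        and ff: "\<And>j. j \<le> Suc L * q \<Longrightarrow> f (a' + j * t) = f a'" by blast
      have "(\<lambda>z. \<chi> (z + a' * x)) ` Z' \<subseteq> C" using \<chi> inE at by auto
      then obtain a Z c where Z: "wins (Suc k) \<Phi> Z" and ZZ: "Z \<subseteq> Z'"
        and c: "\<And>z j. z \<in> Z \<Longrightarrow> j \<le> L \<Longrightarrow> a + j * z \<in> Z' \<and> \<chi> (a + j * z + a' * x) = c"
        by (rule mono_copyE[OF mc]) blast
      have *: "a + a' * x + j * z \<in> ?E \<and> \<chi> (a + a' * x + j * z) = c"
        if "z \<in> extend Z (p Z) (t * x)" "j \<le> L" for z j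
      proof -
        from that(1) obtain y i where z: "z = y + i * (t * x)" "y \<in> Z" "i \<le> p Z"
          unfolding extend_def by blast
        have ji: "j * i \<le> Suc L * q" using that(2) z(3) q[OF ZZ] by (intro mult_le_mono) auto
        then have "j * i * t \<le> Suc L * q * t" by (rule mult_le_mono1)
        then have le: "a' + j * i * t \<le> P" using at by linarith
        have e: "a + a' * x + j * z = (a + j * y) + (a' + j * i * t) * x"
          unfolding z(1) by (simp add: algebra_simps)
        have y: "a + j * y \<in> Z'" "\<chi> (a + j * y + a' * x) = c" using c[OF z(2) that(2)] by auto
        have "\<chi> ((a + j * y) + (a' + j * i * t) * x) = c"
          using fun_cong[OF ff[OF ji], of "a + j * y"] y by (simp add: f_def)
        then show ?thesis unfolding e using inE[OF y(1) le] by simp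
      qed
      have "extend Z (p Z) (t * x) \<subseteq> ?E"
      proof
        fix z assume "z \<in> extend Z (p Z) (t * x)"
        then obtain y i where z: "z = y + i * (t * x)" "y \<in> Z" "i \<le> p Z"
          unfolding extend_def by blast
        have "i * t \<le> q * t" using z(3) q[OF ZZ] by simp
        also have "\<dots> \<le> Suc L * q * t" by simp
        also have "\<dots> \<le> P" using at by linarith
        finally show "z \<in> ?E" using inE[of y "i * t"] z ZZ by (auto simp: mult.assoc)
      qed
      moreover have "wins k \<Phi> (extend Z (p Z) (t * x))" using p[OF Z] t x by simp
      ultimately show ?thesis using * by blast
    qed
    then show "mono_copy C L (wins k \<Phi>) ?E"
      using finite_extend[OF fin] subset_extend[of Z' P x] \<open>0 \<in> Z'\<close> unfolding mono_copy_def by blast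
  qed
qed

text \<open>The colouring is revealed only after all rounds, so it may depend on a later step, as it
  does on \<open>x\<close> in \<open>many_colours_win\<close>.\<close>

lemma wins_mono_copy:
  assumes C: "finite C"
  shows "mono_copy C L (wins k \<Phi>) Z' \<Longrightarrow> wins k (mono_copy C L \<Phi>) Z'"
proof (induction k arbitrary: Z')
  case (Suc k)
  then show ?case using mono_copy_extend[OF C Suc.prems] by fastforce
qed (simp add: mono_copy_def)

section \<open>The exponential Brauer theorem\<close>

text \<open>Reach a monochromatic copy of a set \<open>Z\<close> with more than \<open>k\<close>
  colours, then let a last step \<open>x\<close> colour \<open>s\<close> by
  \<open>g (x * 2 ^ s)\<close>. With \<open>\<alpha> = x * 2 ^ a\<close>, assumption
  \<open>no\<close> keeps the copy's colour off \<open>Z - {0}\<close>, yet \<open>\<alpha>\<close>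
  has that colour and lies in the extension.\<close>

lemma many_colours_win:
  fixes g :: "nat \<Rightarrow> 'c"
  assumes fin: "finite (g ` {1..})"
    and no: "\<And>\<alpha> \<beta>. \<alpha> \<ge> 1 \<Longrightarrow> \<beta> \<ge> 1 \<Longrightarrow> \<exists>j\<le>L. g (\<alpha> * 2 ^ (j * \<beta>)) \<noteq> g \<beta>"
  shows "wins (Suc k) (\<lambda>Z. k < card (g ` (Z - {0}))) {0}"
proof (induction k)
  case 0
  have "0 < card (g ` (extend {0} 1 x - {0}))" if "x \<ge> 1" for x
  proof -
    have "x \<in> extend {0} 1 x - {0}" using that by (auto simp: extend_def)
    moreover have "finite (extend {0} 1 x)" by (simp add: finite_extend)
    ultimately show ?thesis by (metis card_gt_0_iff empty_iff finite_Diff finite_imageI image_is_empty)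
  qed
  then show ?case by (simp only: wins.simps) blast
next
  case (Suc k)
  let ?\<Phi> = "\<lambda>k Z. k < card (g ` (Z - {0}))"
  let ?C = "g ` {1..}"
  have step: "wins 1 (?\<Phi> (Suc k)) Z'" if mc: "mono_copy ?C L (?\<Phi> k) Z'" for Z'
  proof -
    have finZ: "finite Z'" and Z0: "0 \<in> Z'" using mc by (auto simp: mono_copy_def)
    \<comment> \<open>The bound \<open>2 ^ Max Z'\<close> admits \<open>2 ^ a * x\<close> for every
      \<open>a\<close> in \<open>Z'\<close>.\<close>
    have "?\<Phi> (Suc k) (extend Z' (2 ^ Max Z') x)" if x: "x \<ge> 1" for x
    proof -
      let ?E = "extend Z' (2 ^ Max Z') x"
      have "(\<lambda>s. g (x * 2 ^ s)) ` Z' \<subseteq> ?C" using x by auto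
      then obtain a Z c where Z: "k < card (g ` (Z - {0}))" "Z \<subseteq> Z'"
        and c: "\<And>z j. z \<in> Z \<Longrightarrow> j \<le> L \<Longrightarrow> a + j * z \<in> Z' \<and> g (x * 2 ^ (a + j * z)) = c"
        by (rule mono_copyE[OF mc]) blast
      have "Z \<noteq> {}" using Z by auto
      then have a: "a \<in> Z'" "g (x * 2 ^ a) = c" using c[of _ 0] by auto
      have "2 ^ a \<le> (2::nat) ^ Max Z'" using a finZ by (simp add: power_increasing)
      then have "0 + 2 ^ a * x \<in> ?E" unfolding extend_def using Z0 by blast
      then have cE: "c \<in> g ` (?E - {0})" using a(2) x by (auto simp: mult.commute)
      have new: "c \<notin> g ` (Z - {0})"
      proof
        assume "c \<in> g ` (Z - {0})"
        then obtain \<beta> where \<beta>: "\<beta> \<in> Z" "\<beta> \<noteq> 0" "g \<beta> = c" by blast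
        have "g (x * 2 ^ a * 2 ^ (j * \<beta>)) = g \<beta>" if "j \<le> L" for j
          using c[OF \<beta>(1) that] \<beta>(3) by (simp add: power_add mult.assoc)
        then show False using no[of "x * 2 ^ a" \<beta>] x \<beta>(2) by fastforce
      qed
      have finE: "finite (g ` (?E - {0}))" using finite_extend[OF finZ] by blast
      have sub: "insert c (g ` (Z - {0})) \<subseteq> g ` (?E - {0})"
        using cE Z(2) subset_extend[of Z'] by blast
      have "finite (g ` (Z - {0}))" using sub finE by (metis finite_insert finite_subset)
      then have "Suc k < card (insert c (g ` (Z - {0})))" using new Z(1) by simp
      also have "\<dots> \<le> card (g ` (?E - {0}))" by (rule card_mono[OF finE sub])
      finally show ?thesis .
    qed
    then show ?thesis by (simp only: One_nat_def wins.simps) blast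
  qed
  \<comment> \<open>At the start \<open>Z = {0}\<close> and \<open>a = 0\<close> give a one-point
    copy.\<close>
  have "mono_copy ?C L (wins (Suc k) (?\<Phi> k)) {0}"
    using Suc unfolding mono_copy_def by (auto simp del: wins.simps intro!: exI[of _ "{0}"])
  then have "wins (Suc k) (mono_copy ?C L (?\<Phi> k)) {0}" by (rule wins_mono_copy[OF fin])
  then have "wins (Suc k) (wins 1 (?\<Phi> (Suc k))) {0}" using step by (rule wins_mono)
  then show ?case using wins_wins[of "Suc k" 1] by (simp only: add_Suc_right Suc_eq_plus1)
qed

theorem exponential_Brauer:
  fixes g :: "nat \<Rightarrow> 'c"
  assumes fin: "finite (g ` {1..})"
  obtains \<alpha> \<beta> where "\<alpha> \<ge> 1" "\<beta> \<ge> 1" "\<And>j. j \<le> L \<Longrightarrow> g (\<alpha> * 2 ^ (j * \<beta>)) = g \<beta>"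
proof (rule ccontr)
  assume "\<not> thesis"
  then have "\<exists>j\<le>L. g (\<alpha> * 2 ^ (j * \<beta>)) \<noteq> g \<beta>" if "\<alpha> \<ge> 1" "\<beta> \<ge> 1" for \<alpha> \<beta>
    using that \<open>\<And>\<alpha> \<beta>. \<lbrakk>1 \<le> \<alpha>; 1 \<le> \<beta>; \<And>j. j \<le> L \<Longrightarrow> g (\<alpha> * 2 ^ (j * \<beta>)) = g \<beta>\<rbrakk> \<Longrightarrow> thesis\<close> by blast
  from wins_ex[OF many_colours_win[OF fin this, of "card (g ` {1..})"]]
  obtain Z where "card (g ` {1..}) < card (g ` (Z - {0}))" by auto
  moreover have "card (g ` (Z - {0})) \<le> card (g ` {1..})"
    using fin by (intro card_mono image_mono) auto
  ultimately show False by simp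
qed

section \<open>Compactness\<close>

text \<open>Diagonal argument: on nested infinite index sets \<open>S n\<close> the value at
  \<open>n\<close> is constant, so any member of \<open>S n\<close> agrees with the limit on
  \<open>{..n}\<close>.\<close>

lemma limit_colouring:
  fixes F :: "nat \<Rightarrow> nat \<Rightarrow> 'c"
  assumes C: "finite C" and F: "\<And>M x. F M x \<in> C"
  obtains f where "\<And>x. f x \<in> C" "\<And>n. \<exists>M\<ge>n. \<forall>x\<le>n. F M x = f x"
proof -
  have ext: "\<exists>S'. infinite S' \<and> S' \<subseteq> S \<and> (\<exists>c. \<forall>M\<in>S'. F M n = c)" if "infinite S" for S n
  proof -
    have "finite ((\<lambda>M. F M n) ` S)" using C F by (meson finite_subset image_subsetI)
    from pigeonhole_infinite[OF that this] obtain M0 where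
      "infinite {M \<in> S. F M n = F M0 n}" by blast
    then show ?thesis by (intro exI[of _ "{M \<in> S. F M n = F M0 n}"]) auto
  qed
  have "\<exists>S. \<forall>n. (infinite (S n) \<and> (\<exists>c. \<forall>M\<in>S n. F M n = c)) \<and> S (Suc n) \<subseteq> S n"
  proof (rule dependent_nat_choice)
    show "\<exists>S. infinite S \<and> (\<exists>c. \<forall>M\<in>S. F M 0 = c)" using ext[of UNIV 0] by auto
    show "\<exists>S'. (infinite S' \<and> (\<exists>c. \<forall>M\<in>S'. F M (Suc n) = c)) \<and> S' \<subseteq> S"
      if "infinite S \<and> (\<exists>c. \<forall>M\<in>S. F M n = c)" for S n
      using ext[of S "Suc n"] that by metis
  qed
  then obtain S where inf: "\<And>n. infinite (S n)" and const: "\<And>n. \<exists>c. \<forall>M\<in>S n. F M n = c"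
    and dec: "\<And>n. S (Suc n) \<subseteq> S n" by blast
  obtain f where f: "\<And>n M. M \<in> S n \<Longrightarrow> F M n = f n" using const by metis
  show ?thesis
  proof (rule that[of f])
    show "f x \<in> C" for x
    proof -
      obtain M where "M \<in> S x" using inf[of x] by (metis finite.emptyI ex_in_conv)
      then show ?thesis using f F by metis
    qed
    show "\<exists>M\<ge>n. \<forall>x\<le>n. F M x = f x" for n
    proof -
      obtain M where M: "M \<ge> n" "M \<in> S n" using inf[of n] by (metis infinite_nat_iff_unbounded_le)
      have "S n \<subseteq> S x" if "x \<le> n" for x using lift_Suc_antimono_le[of S, OF dec that] .
      then show ?thesis using M f by blast
    qed
  qed
qed

text \<open>Colourings that are bad up to every \<open>M\<close> would have a limit that is bad for
  all of \<open>A\<close>.\<close>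

lemma partition_regular_bounded:
  assumes "partition_regular A" and C: "finite (C :: nat set)" and "C \<noteq> {}"
  obtains M where "\<And>f. (\<And>x. f x \<in> C) \<Longrightarrow>
    \<exists>xs\<in>A. set xs \<subseteq> {..M} \<and> (\<forall>x\<in>set xs. \<forall>y\<in>set xs. f x = f y)"
proof (rule ccontr)
  assume "\<not> thesis"
  then have "\<forall>M. \<exists>f. (\<forall>x. f x \<in> C) \<and>
      (\<forall>xs\<in>A. set xs \<subseteq> {..M} \<longrightarrow> \<not> (\<forall>x\<in>set xs. \<forall>y\<in>set xs. f x = f y))"
    using that by metis
  then obtain F where F: "\<And>M x. F M x \<in> C" and bad: "\<And>M xs. xs \<in> A \<Longrightarrow> set xs \<subseteq> {..M} \<Longrightarrow>
      \<not> (\<forall>x\<in>set xs. \<forall>y\<in>set xs. F M x = F M y)"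
    by metis
  obtain f where fC: "\<And>x. f x \<in> C" and lim: "\<And>n. \<exists>M\<ge>n. \<forall>x\<le>n. F M x = f x"
    using limit_colouring[of C F] C F by metis
  have "finite_colouring f"
    unfolding finite_colouring_def using fC C by (meson finite_subset image_subsetI)
  then obtain xs where xs: "xs \<in> A" "\<forall>x\<in>set xs. \<forall>y\<in>set xs. f x = f y"
    using assms(1) unfolding partition_regular_def by blast
  obtain M where M: "M \<ge> Max (set xs)" "\<forall>x\<le>Max (set xs). F M x = f x" using lim by blast
  have "x \<le> Max (set xs)" if "x \<in> set xs" for x using that by simp
  then have sub: "set xs \<subseteq> {..M}" and F_eq: "\<And>x. x \<in> set xs \<Longrightarrow> F M x = f x" using M(2) order_trans[OF _ M(1)] by blast+
  have "F M x = F M y" if "x \<in> set xs" "y \<in> set xs" for x y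
    using xs(2)[rule_format, OF that] F_eq[OF that(1)] F_eq[OF that(2)] by simp
  then show False using bad[OF xs(1) sub] by blast
qed

section \<open>Exponential patterns\<close>

theorem theorem2:
  fixes n :: nat and W :: "nat list \<Rightarrow> nat" and A :: "nat list set"
  assumes "n \<ge> 1"
    and "\<And>xs. xs \<in> pos_tuples n \<Longrightarrow> W xs \<ge> 1"
    and "A \<subseteq> pos_tuples n"
    and "partition_regular A"
  shows "partition_regular (exponential_pattern A W)"
  unfolding partition_regular_def
proof (intro allI impI)
  fix f assume "finite_colouring f"
  then have finf: "finite (f ` {1..})" by (simp add: finite_colouring_def)
  define g where "g k = f (2 ^ k)" for k :: nat
  define C where "C = f ` {1..}"
  have C: "finite C" "C \<noteq> {}" using finf by (auto simp: C_def)
  have gC: "g k \<in> C" for k by (auto simp: g_def C_def)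
  obtain M where M: "\<And>f. (\<And>x. f x \<in> C) \<Longrightarrow>
      \<exists>xs\<in>A. set xs \<subseteq> {..M} \<and> (\<forall>x\<in>set xs. \<forall>y\<in>set xs. f x = f y)"
    using partition_regular_bounded[OF assms(4) C] by metis
  define B where "B = {xs \<in> A. set xs \<subseteq> {..M}}"
  have "B \<subseteq> {xs. set xs \<subseteq> {..M} \<and> length xs = n}"
    using assms(3) by (auto simp: B_def pos_tuples_def)
  then have finB: "finite B" using finite_lists_length_eq finite_subset by blast
  \<comment> \<open>\<open>M\<close> is fixed before \<open>\<alpha>\<close> and
    \<open>\<beta>\<close>, so one length \<open>L\<close> serves every tuple that may be chosen
    later.\<close>
  define L where "L = Max (W ` B)"
  have L: "W xs \<le> L" if "xs \<in> B" for xs using that finB unfolding L_def by (intro Max_ge) auto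
  define h where "h y = restrict (\<lambda>x. g (x * y)) {..M}" for y
  have "h ` {1..} \<subseteq> {..M} \<rightarrow>\<^sub>E C" unfolding h_def image_subset_iff using gC by (simp add: restrict_PiE_iff)
  then have "finite (h ` {1..})" using finite_PiE[of "{..M}" "\<lambda>_. C"] C finite_subset by blast
  then obtain \<alpha> \<beta> where ab: "\<alpha> \<ge> 1" "\<beta> \<ge> 1" and hh: "\<And>j. j \<le> L \<Longrightarrow> h (\<alpha> * 2 ^ (j * \<beta>)) = h \<beta>"
    using exponential_Brauer[of h L] by metis
  have gg: "g (x * (\<alpha> * 2 ^ (j * \<beta>))) = g (x * \<beta>)" if "x \<le> M" "j \<le> L" for x j
    using fun_cong[OF hh[OF that(2)], of x] that(1) by (simp add: h_def)
  obtain xs where xs: "xs \<in> A" "set xs \<subseteq> {..M}"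
    and eq: "\<forall>x\<in>set xs. \<forall>y\<in>set xs. g (x * \<beta>) = g (y * \<beta>)"
    using M[of "\<lambda>x. g (x * \<beta>)"] gC by blast
  have len: "length xs = n" "set xs \<subseteq> {1..}" using xs(1) assms(3) by (auto simp: pos_tuples_def)
  then obtain x where x: "x \<in> set xs" using assms(1) by (cases xs) auto
  have x1: "x \<ge> 1" "x \<le> M" using x len(2) xs(2) by auto
  \<comment> \<open>The factor \<open>x\<close> ties the powers of \<open>a\<close> to coordinate
    \<open>x\<close> of the vector, hence to the colour of \<open>b ^ x\<close>.\<close>
  define a where "a = (2::nat) ^ (x * \<alpha>)"
  define b where "b = (2::nat) ^ \<beta>"
  have "a > 1" "b > 1" using ab x1 by (simp_all add: a_def b_def one_less_power del: One_nat_def)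
  define ys where "ys = a # map (\<lambda>x. b ^ x) xs @ map (\<lambda>j. a ^ (b ^ j)) [1..<Suc (W xs)]"
  have "f (b ^ y) = g (x * \<beta>)" if "y \<in> set xs" for y
    using eq[rule_format, OF that x] by (simp add: b_def g_def mult.commute[of \<beta>] flip: power_mult)
  moreover have pow: "f (a ^ (b ^ j)) = g (x * \<beta>)" if "j \<le> W xs" for j
  proof -
    have "a ^ (b ^ j) = 2 ^ (x * (\<alpha> * 2 ^ (j * \<beta>)))"
      by (simp add: a_def b_def mult_ac flip: power_mult)
    moreover have "j \<le> L" using that L[of xs] xs by (simp add: B_def)
    ultimately show ?thesis using gg[OF x1(2)] by (simp add: g_def)
  qed
  \<comment> \<open>The case \<open>j = 0\<close> is \<open>a\<close> itself, as
    \<open>b ^ 0 = 1\<close>.\<close>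
  moreover have "f a = g (x * \<beta>)" using pow[of 0] by simp
  ultimately have "\<forall>y\<in>set ys. f y = g (x * \<beta>)" unfolding ys_def by auto
  moreover have "ys \<in> exponential_pattern A W"
    unfolding exponential_pattern_def ys_def using xs(1) \<open>a > 1\<close> \<open>b > 1\<close> by blast
  ultimately show "\<exists>xs\<in>exponential_pattern A W. \<forall>x\<in>set xs. \<forall>y\<in>set xs. f x = f y"
    by metis
qed

end
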